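(* Let $k\ge1$ be an integer and let $G$ be a graph of order $n$ with minimum degree $\delta>0$. Put $$r=\left\lfloor\frac{k}{\delta+1}\right\rfloor+1,\quad \theta=(\delta+1)r-k,\quad B_{k-1}=\binom{(\delta+1)r}{k-1},\quad \rho=\frac1\theta .$$ Then $$\gamma_{\{k\}}(G)\le\left(1-\frac{(r\rho)^{\rho}}{(1+\rho)^{1+\rho}\,B_{k-1}^{\rho}}\right)rn ,$$ and also $$\gamma_{\{k\}}(G)\le\frac{\ln(\theta+1)+\ln B_{k-1}-\ln r+1}{\theta+1}\,rn .$$
   Context: All graphs are finite, undirected, without loops and multiple edges (and nonempty). $N[v]$ denotes the closed neighbourhood of $v$ (the neighbours of $v$ together with $v$). A function $f:V(G)\to\{0,1,\dots,k\}$ is $\{k\}$-dominating if $\sum_{u\in N[v]}f(u)\ge k$ for every vertex $v\in V(G)$. The weight of $f$ is $\sum_{v\in V(G)}f(v)$. The $\{k\}$-domination number $\gamma_{\{k\}}(G)$ is the smallest weight of a $\{k\}$-dominating function of $G$. *)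

theory Defs
  imports Complex_Main "Graph_Theory.Digraph"
begin

text \<open>
  Undirected simple graphs are the symmetric digraphs of locale \<^locale>\<open>graph\<close>: finite, without
  loops and without parallel arcs, every edge being represented by a pair of opposite arcs.
  Hence the degree of a vertex is its out-degree. The locale admits the null graph.
\<close>

definition min_degree :: "('a, 'b) pre_digraph \<Rightarrow> nat" where
  "min_degree G = Min (out_degree G ` verts G)"

definition closed_nbhd :: "('a, 'b) pre_digraph \<Rightarrow> 'a \<Rightarrow> 'a set" where
  "closed_nbhd G v = insert v {u. v \<rightarrow>\<^bsub>G\<^esub> u}"

text \<open>Values of \<open>f\<close> outside \<open>verts G\<close> are irrelevant.\<close>

definition k_dominating :: "nat \<Rightarrow> ('a, 'b) pre_digraph \<Rightarrow> ('a \<Rightarrow> nat) \<Rightarrow> bool" where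
  "k_dominating k G f \<longleftrightarrow>
     (\<forall>v\<in>verts G. f v \<in> {0..k}) \<and> (\<forall>v\<in>verts G. k \<le> (\<Sum>u\<in>closed_nbhd G v. f u))"

definition weight :: "('a, 'b) pre_digraph \<Rightarrow> ('a \<Rightarrow> nat) \<Rightarrow> nat" where
  "weight G f = (\<Sum>v\<in>verts G. f v)"

definition k_domination_number :: "nat \<Rightarrow> ('a, 'b) pre_digraph \<Rightarrow> nat" where
  "k_domination_number k G = (LEAST w. \<exists>f. k_dominating k G f \<and> weight G f = w)"

lemma (in wf_digraph) closed_nbhd_subset: "v \<in> verts G \<Longrightarrow> closed_nbhd G v \<subseteq> verts G"
  by (auto simp: closed_nbhd_def dest: adj_in_verts)

lemma (in fin_digraph) k_dominating_const: "k_dominating k G (\<lambda>_. k)"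
proof -
  have "k \<le> (\<Sum>u\<in>closed_nbhd G v. k)" if "v \<in> verts G" for v
  proof -
    have "finite (closed_nbhd G v)"
      using closed_nbhd_subset[OF that] finite_verts by (rule finite_subset)
    moreover have "v \<in> closed_nbhd G v" by (simp add: closed_nbhd_def)
    ultimately show ?thesis by (rule member_le_sum[rotated 2]) simp_all
  qed
  then show ?thesis by (simp add: k_dominating_def)
qed

lemma (in fin_digraph) k_domination_number_attained:
  "\<exists>f. k_dominating k G f \<and> weight G f = k_domination_number k G"
  unfolding k_domination_number_def
  by (rule LeastI_ex) (use k_dominating_const in blast)

lemma k_domination_number_le: "k_dominating k G f \<Longrightarrow> k_domination_number k G \<le> weight G f"
  unfolding k_domination_number_def by (rule Least_le) blast

end

theory Submission
  imports Defs
begin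

text \<open>
  The proof is probabilistic. Write \<open>d = \<delta> + 1\<close> and give every vertex \<open>r\<close> tokens, each kept
  independently with probability \<open>1 - q\<close>. Let \<open>f v\<close> be the number of tokens kept at \<open>v\<close>. Every closed
  neighbourhood contains a set of \<open>d\<close> vertices including its centre, which carries \<open>d r \<ge> k\<close> tokens
  in all. If only \<open>m < k\<close> of these are kept, raise \<open>f v\<close> by the deficit \<open>k - m\<close>; the result is
  \<open>{k}\<close>-dominating.

  The expected number of kept tokens is \<open>r n (1 - q)\<close>. For the deficit, count the
  \<open>(k - 1)\<close>-sets \<open>Z\<close> of the \<open>d r\<close> tokens that contain all the kept ones: there are at least \<open>k - m\<close>
  of them (\<open>deficit_le_card_supersets\<close>), and a given \<open>Z\<close> contains all the kept tokens exactly if the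
  \<open>d r - k + 1\<close> tokens outside \<open>Z\<close> are all dropped, which has probability \<open>q ^ (d r - k + 1)\<close>. So, with
  \<open>\<theta> = d r - k\<close>,
  \[ \gamma_{\{k\}}(G) \le r n (1 - q) + n B_{k-1} q^{\theta + 1} \quad (0 \le q \le 1), \]
  which is \<open>k_domination_number_le_random\<close>. The right-hand side is least at
  \<open>q = x powr (1 / \<theta>)\<close> where \<open>x = r / ((\<theta> + 1) B)\<close>, and this \<open>q\<close> gives the first
  bound. For the second bound, use \<open>q \<le> exp (q - 1)\<close> and minimise the resulting upper estimate
  \<open>r n p + n B exp (- p (\<theta> + 1))\<close> in \<open>p = 1 - q\<close>, whose minimum is at
  \<open>p = - ln x / (\<theta> + 1)\<close>.
\<close>

section \<open>Random subsets of a finite set\<close>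

text \<open>Every element of \<open>S\<close> is kept independently with probability \<open>1 - q\<close>.\<close>

definition subset_prob :: "real \<Rightarrow> 'a set \<Rightarrow> 'a set \<Rightarrow> real" where
  "subset_prob q S X = (1 - q) ^ card X * q ^ card (S - X)"

lemma subset_prob_nonneg: "0 \<le> q \<Longrightarrow> q \<le> 1 \<Longrightarrow> 0 \<le> subset_prob q S X"
  by (simp add: subset_prob_def)

text \<open>
  The product \<open>\<Prod>x\<in>S. a x + q\<close>, with \<open>a x = 0\<close> on \<open>U\<close> and \<open>a x = 1 - q\<close> elsewhere, expands into exactly
  the probabilities of those \<open>X\<close> that avoid \<open>U\<close>.
\<close>

lemma prob_avoids:
  assumes "finite S" and "U \<subseteq> S"
  shows "(\<Sum>X\<in>Pow S. subset_prob q S X * of_bool (X \<inter> U = {})) = q ^ card U"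
proof -
  define a where "a = (\<lambda>x. if x \<in> U then 0 else 1 - q)"
  have expand: "subset_prob q S X * of_bool (X \<inter> U = {}) = (\<Prod>x\<in>X. a x) * (\<Prod>x\<in>S - X. q)"
    if "X \<in> Pow S" for X
  proof (cases "X \<inter> U = {}")
    case True
    then have "(\<Prod>x\<in>X. a x) = (\<Prod>x\<in>X. 1 - q)"
      by (intro prod.cong) (auto simp: a_def)
    then show ?thesis using True by (simp add: subset_prob_def)
  next
    case False
    moreover have "finite X" using that assms(1) finite_subset by auto
    ultimately have "(\<Prod>x\<in>X. a x) = 0" by (auto simp: a_def prod_zero_iff)
    then show ?thesis using False by simp
  qed
  have "(\<Sum>X\<in>Pow S. subset_prob q S X * of_bool (X \<inter> U = {})) =
      (\<Sum>X\<in>Pow S. (\<Prod>x\<in>X. a x) * (\<Prod>x\<in>S - X. q))"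
    by (intro sum.cong refl expand)
  also have "\<dots> = (\<Prod>x\<in>S. a x + q)"
    using prod_add[OF assms(1), of a "\<lambda>_. q"] by simp
  also have "\<dots> = (\<Prod>x\<in>U. a x + q) * (\<Prod>x\<in>S - U. a x + q)"
    using prod.subset_diff[OF assms(2,1), of "\<lambda>x. a x + q"] by (simp add: mult.commute)
  also have "(\<Prod>x\<in>U. a x + q) = q ^ card U" by (simp add: a_def)
  also have "(\<Prod>x\<in>S - U. a x + q) = 1" by (intro prod.neutral) (auto simp: a_def)
  finally show ?thesis by simp
qed

lemma subset_prob_total: "finite S \<Longrightarrow> (\<Sum>X\<in>Pow S. subset_prob q S X) = 1"
  using prob_avoids[of S "{}" q] by simp

lemma expected_card:
  assumes "finite S"
  shows "(\<Sum>X\<in>Pow S. subset_prob q S X * real (card X)) = (1 - q) * real (card S)"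
proof -
  have "real (card X) = (\<Sum>x\<in>S. 1 - of_bool (X \<inter> {x} = {}))" if "X \<in> Pow S" for X
  proof -
    have "(\<Sum>x\<in>S. 1 - of_bool (X \<inter> {x} = {}) :: real) = (\<Sum>x\<in>S. of_bool (x \<in> X))"
      by (intro sum.cong) auto
    also have "\<dots> = real (card (S \<inter> X))" using assms by (simp add: Int_def)
    also have "S \<inter> X = X" using that by auto
    finally show ?thesis by simp
  qed
  then have "(\<Sum>X\<in>Pow S. subset_prob q S X * real (card X)) =
      (\<Sum>X\<in>Pow S. \<Sum>x\<in>S. subset_prob q S X - subset_prob q S X * of_bool (X \<inter> {x} = {}))"
    by (intro sum.cong refl) (simp add: sum_distrib_left right_diff_distrib)
  also have "\<dots> = (\<Sum>x\<in>S. \<Sum>X\<in>Pow S. subset_prob q S X - subset_prob q S X * of_bool (X \<inter> {x} = {}))"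
    by (rule sum.swap)
  also have "\<dots> = (\<Sum>x\<in>S. 1 - q)"
    using assms by (intro sum.cong refl)
      (simp only: sum_subtractf subset_prob_total prob_avoids insert_subset empty_subsetI simp_thms, simp)
  finally show ?thesis by simp
qed

text \<open>
  Extend \<open>Y\<close> to a \<open>k\<close>-set \<open>W\<close> inside \<open>T\<close>. Each of the \<open>k - card Y\<close> elements of \<open>W - Y\<close> can be removed
  from \<open>W\<close>, with a different result each time.
\<close>

lemma deficit_le_card_supersets:
  assumes "finite T" and "Y \<subseteq> T" and "k \<le> card T"
  shows "k - card Y \<le> card {Z. Y \<subseteq> Z \<and> Z \<subseteq> T \<and> card Z = k - 1}"
proof (cases "card Y \<le> k")
  case True
  then obtain W where W: "Y \<subseteq> W" "W \<subseteq> T" "card W = k"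
    using exists_subset_between[of Y k T] assms by auto
  have fin: "finite W" using W(2) assms(1) by (rule finite_subset)
  have "k - card Y = card (W - Y)"
    using W fin by (simp add: card_Diff_subset finite_subset)
  also have "\<dots> = card ((\<lambda>w. W - {w}) ` (W - Y))"
    by (intro card_image[symmetric] inj_onI) auto
  also have "\<dots> \<le> card {Z. Y \<subseteq> Z \<and> Z \<subseteq> T \<and> card Z = k - 1}"
    using W assms(1) fin by (intro card_mono) auto
  finally show ?thesis .
qed simp

text \<open>A union bound over the \<open>(k - 1)\<close>-sets that may contain the random part of \<open>T\<close>.\<close>

lemma expected_deficit_le:
  assumes "finite S" and "T \<subseteq> S" and "1 \<le> k" and "k \<le> card T" and "0 \<le> q" and "q \<le> 1"
  shows "(\<Sum>X\<in>Pow S. subset_prob q S X * real (k - card (X \<inter> T)))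
           \<le> real (card T choose (k - 1)) * q ^ (card T - k + 1)"
proof -
  define \<Z> where "\<Z> = {Z. Z \<subseteq> T \<and> card Z = k - 1}"
  have finT: "finite T" using assms(2,1) by (rule finite_subset)
  then have fin: "finite \<Z>" unfolding \<Z>_def by simp
  have deficit: "real (k - card (X \<inter> T)) \<le> (\<Sum>Z\<in>\<Z>. of_bool (X \<inter> (T - Z) = {}))" for X
  proof -
    have "k - card (X \<inter> T) \<le> card {Z. X \<inter> T \<subseteq> Z \<and> Z \<subseteq> T \<and> card Z = k - 1}"
      using finT assms(4) by (intro deficit_le_card_supersets) auto
    also have "{Z. X \<inter> T \<subseteq> Z \<and> Z \<subseteq> T \<and> card Z = k - 1} = \<Z> \<inter> {Z. X \<inter> (T - Z) = {}}"
      by (auto simp: \<Z>_def)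
    finally show ?thesis using fin by simp
  qed
  have "(\<Sum>X\<in>Pow S. subset_prob q S X * real (k - card (X \<inter> T)))
      \<le> (\<Sum>X\<in>Pow S. subset_prob q S X * (\<Sum>Z\<in>\<Z>. of_bool (X \<inter> (T - Z) = {})))"
    using assms(5,6) by (intro sum_mono mult_left_mono deficit subset_prob_nonneg)
  also have "\<dots> = (\<Sum>Z\<in>\<Z>. \<Sum>X\<in>Pow S. subset_prob q S X * of_bool (X \<inter> (T - Z) = {}))"
    unfolding sum_distrib_left by (rule sum.swap)
  also have "\<dots> = (\<Sum>Z\<in>\<Z>. q ^ (card T - k + 1))"
  proof (intro sum.cong refl)
    fix Z assume Z: "Z \<in> \<Z>"
    have "card (T - Z) = card T - k + 1"
    proof -
      have "card (T - Z) = card T - (k - 1)"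
        using Z finT by (auto simp: \<Z>_def card_Diff_subset finite_subset)
      then show ?thesis using assms(3,4) by simp
    qed
    moreover have "T - Z \<subseteq> S" using assms(2) by auto
    ultimately show "(\<Sum>X\<in>Pow S. subset_prob q S X * of_bool (X \<inter> (T - Z) = {})) = q ^ (card T - k + 1)"
      using prob_avoids[OF assms(1), of "T - Z" q] by simp
  qed
  also have "\<dots> = real (card T choose (k - 1)) * q ^ (card T - k + 1)"
    using n_subsets[OF finT, of "k - 1"] by (simp add: \<Z>_def)
  finally show ?thesis .
qed

section \<open>From a random token set to a dominating function\<close>

lemma (in graph) min_degree_less_card_closed_nbhd:
  assumes "v \<in> verts G"
  shows "min_degree G + 1 \<le> card (closed_nbhd G v)"
proof -
  have nbrs: "{u. v \<rightarrow>\<^bsub>G\<^esub> u} = head G ` out_arcs G v"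
    by (force simp: arcs_ends_def arc_to_ends_def out_arcs_def)
  have "inj_on (head G) (out_arcs G v)"
    by (auto intro!: inj_onI no_multi_arcs simp: arc_to_ends_def)
  then have "card {u. v \<rightarrow>\<^bsub>G\<^esub> u} = out_degree G v"
    by (simp add: nbrs card_image out_degree_def)
  moreover have "v \<notin> {u. v \<rightarrow>\<^bsub>G\<^esub> u}"
    using no_loops by (force simp: nbrs out_arcs_def)
  moreover have "finite (out_arcs G v)"
    by (rule finite_subset[OF _ finite_arcs]) auto
  then have "finite {u. v \<rightarrow>\<^bsub>G\<^esub> u}"
    unfolding nbrs by (rule finite_imageI)
  ultimately have "card (closed_nbhd G v) = out_degree G v + 1"
    by (simp add: closed_nbhd_def)
  moreover have "min_degree G \<le> out_degree G v"
    using assms by (simp add: min_degree_def)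
  ultimately show ?thesis by simp
qed

text \<open>
  Tokens are the pairs \<open>(v, i)\<close> with \<open>i < r\<close>, and \<open>X\<close> is the set of kept ones. The deficit at \<open>v\<close> is
  measured on \<open>N v\<close>, a part of the closed neighbourhood, because parts of equal size give the same
  expected deficit bound at every vertex. The values stay at most \<open>k\<close>: a vertex with a positive
  deficit holds at most as many kept tokens as \<open>N v\<close> does, and any other vertex holds at most \<open>r \<le> k\<close>.
\<close>

lemma (in fin_digraph) k_domination_number_le_tokens:
  fixes N :: "'a \<Rightarrow> 'a set"
  assumes N: "\<And>v. v \<in> verts G \<Longrightarrow> v \<in> N v \<and> N v \<subseteq> closed_nbhd G v"
    and "r \<le> k" and X: "X \<subseteq> verts G \<times> {..<r}"
  shows "k_domination_number k G \<le> card X + (\<Sum>v\<in>verts G. k - card (X \<inter> N v \<times> {..<r}))"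
proof -
  define g where "g v = card (X \<inter> {v} \<times> {..<r})" for v
  define f where "f v = g v + (k - card (X \<inter> N v \<times> {..<r}))" for v
  have finX: "finite X" using X by (rule finite_subset) simp
  have g_sum: "(\<Sum>u\<in>A. g u) = card (X \<inter> A \<times> {..<r})" if "finite A" for A
  proof -
    have "card (\<Union>u\<in>A. X \<inter> {u} \<times> {..<r}) = (\<Sum>u\<in>A. g u)"
      unfolding g_def using that finX by (intro card_UN_disjoint) auto
    moreover have "(\<Union>u\<in>A. X \<inter> {u} \<times> {..<r}) = X \<inter> A \<times> {..<r}" by auto
    ultimately show ?thesis by simp
  qed
  have fin_nbhd: "finite (closed_nbhd G v)" if "v \<in> verts G" for v
    using closed_nbhd_subset[OF that] finite_verts by (rule finite_subset)
  have "f v \<le> k" if v: "v \<in> verts G" for v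
  proof -
    have "g v \<le> card (X \<inter> N v \<times> {..<r})"
      unfolding g_def using N[OF v] finX by (intro card_mono) auto
    moreover have "g v \<le> card ({v} \<times> {..<r})"
      unfolding g_def by (intro card_mono) auto
    ultimately show ?thesis using \<open>r \<le> k\<close> by (simp add: f_def)
  qed
  moreover have "k \<le> (\<Sum>u\<in>closed_nbhd G v. f u)" if v: "v \<in> verts G" for v
  proof -
    have fin: "finite (N v)" using N[OF v] fin_nbhd[OF v] by (auto intro: finite_subset)
    have "k \<le> (\<Sum>u\<in>N v. g u) + (k - card (X \<inter> N v \<times> {..<r}))"
      by (simp add: g_sum fin)
    also have "\<dots> \<le> (\<Sum>u\<in>N v. g u) + (\<Sum>u\<in>N v. k - card (X \<inter> N u \<times> {..<r}))"
      using N[OF v] fin by (intro add_left_mono member_le_sum) auto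
    also have "\<dots> = (\<Sum>u\<in>N v. f u)" by (simp add: f_def sum.distrib)
    also have "\<dots> \<le> (\<Sum>u\<in>closed_nbhd G v. f u)"
      using N[OF v] fin_nbhd[OF v] by (intro sum_mono2) auto
    finally show ?thesis .
  qed
  ultimately have "k_dominating k G f" by (simp add: k_dominating_def)
  then have "k_domination_number k G \<le> weight G f" by (rule k_domination_number_le)
  also have "\<dots> = card X + (\<Sum>v\<in>verts G. k - card (X \<inter> N v \<times> {..<r}))"
    using X by (simp add: weight_def f_def sum.distrib g_sum Int_absorb2)
  finally show ?thesis .
qed

text \<open>The minimum over all token sets is at most the average.\<close>

theorem (in fin_digraph) k_domination_number_le_random:
  assumes d: "\<And>v. v \<in> verts G \<Longrightarrow> d \<le> card (closed_nbhd G v)"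
    and "1 \<le> k" and "r \<le> k" and "k \<le> d * r" and "0 \<le> q" and "q \<le> 1"
  shows "real (k_domination_number k G)
           \<le> real r * real (card (verts G)) * (1 - q)
             + real (card (verts G)) * (real (d * r choose (k - 1)) * q ^ (d * r - k + 1))"
proof -
  have "1 \<le> d" using assms(2,4) by (cases d) auto
  have "\<exists>A. v \<in> A \<and> A \<subseteq> closed_nbhd G v \<and> card A = d" if v: "v \<in> verts G" for v
  proof -
    have "finite (closed_nbhd G v)"
      using closed_nbhd_subset[OF v] finite_verts by (rule finite_subset)
    then show ?thesis
      using exists_subset_between[of "{v}" d "closed_nbhd G v"] d[OF v] \<open>1 \<le> d\<close>
      by (auto simp: closed_nbhd_def)
  qed
  then obtain N where N: "\<And>v. v \<in> verts G \<Longrightarrow> v \<in> N v \<and> N v \<subseteq> closed_nbhd G v \<and> card (N v) = d"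
    by metis
  define S where "S = verts G \<times> {..<r}"
  have finS: "finite S" by (simp add: S_def)
  let ?\<gamma> = "k_domination_number k G" and ?P = "subset_prob q S" and ?T = "\<lambda>v. N v \<times> {..<r}"
  have "real ?\<gamma> = (\<Sum>X\<in>Pow S. ?P X * real ?\<gamma>)"
    using subset_prob_total[OF finS, of q] by (simp flip: sum_distrib_right)
  also have "\<dots> \<le> (\<Sum>X\<in>Pow S. ?P X * (real (card X) + (\<Sum>v\<in>verts G. real (k - card (X \<inter> ?T v)))))"
  proof (intro sum_mono mult_left_mono subset_prob_nonneg assms)
    fix X assume "X \<in> Pow S"
    then have "?\<gamma> \<le> card X + (\<Sum>v\<in>verts G. k - card (X \<inter> ?T v))"
      using N \<open>r \<le> k\<close> by (intro k_domination_number_le_tokens) (auto simp: S_def)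
    then have "real ?\<gamma> \<le> real (card X + (\<Sum>v\<in>verts G. k - card (X \<inter> ?T v)))"
      by (rule of_nat_mono)
    then show "real ?\<gamma> \<le> real (card X) + (\<Sum>v\<in>verts G. real (k - card (X \<inter> ?T v)))"
      by simp
  qed
  also have "\<dots> = (\<Sum>X\<in>Pow S. ?P X * real (card X))
      + (\<Sum>X\<in>Pow S. \<Sum>v\<in>verts G. ?P X * real (k - card (X \<inter> ?T v)))"
    by (simp add: distrib_left sum.distrib sum_distrib_left)
  also have "\<dots> = (1 - q) * real (card S)
      + (\<Sum>v\<in>verts G. \<Sum>X\<in>Pow S. ?P X * real (k - card (X \<inter> ?T v)))"
    unfolding expected_card[OF finS] by (subst sum.swap) (rule refl)
  also have "\<dots> \<le> (1 - q) * real (card S)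
      + (\<Sum>v\<in>verts G. real (d * r choose (k - 1)) * q ^ (d * r - k + 1))"
  proof (intro add_left_mono sum_mono)
    fix v assume v: "v \<in> verts G"
    have cT: "card (?T v) = d * r" using N[OF v] by (simp add: card_cartesian_product)
    have "?T v \<subseteq> S" using N[OF v] closed_nbhd_subset[OF v] by (auto simp: S_def)
    then show "(\<Sum>X\<in>Pow S. ?P X * real (k - card (X \<inter> ?T v)))
        \<le> real (d * r choose (k - 1)) * q ^ (d * r - k + 1)"
      using expected_deficit_le[of S "?T v" k q] finS assms by (simp add: cT)
  qed
  also have "\<dots> = real r * real (card (verts G)) * (1 - q)
      + real (card (verts G)) * (real (d * r choose (k - 1)) * q ^ (d * r - k + 1))"
    by (simp add: S_def card_cartesian_product)
  finally show ?thesis .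
qed

section \<open>Choosing the probability\<close>

text \<open>
  By absorption the right-hand side is \<open>d r\<close> times a positive binomial coefficient. The inequality
  says that \<open>r / ((t + 1) B) \<le> 1\<close>, which puts the choices of \<open>q\<close> for both bounds into \<open>[0, 1]\<close>.
\<close>

lemma tokens_le_binomial:
  assumes "1 \<le> k" and "1 \<le> d" and "d * r = k + t"
  shows "r \<le> (t + 1) * (d * r choose (k - 1))"
proof -
  have "d * r choose (k - 1) = d * r choose Suc t"
    using assms binomial_symmetric[of "k - 1" "d * r"] by simp
  then have "(t + 1) * (d * r choose (k - 1)) = d * r * ((d * r - 1) choose t)"
    using binomial_absorption[of t "d * r"] by simp
  moreover have "0 < (d * r - 1) choose t" using assms by (simp add: zero_less_binomial)
  moreover have "r \<le> d * r" using \<open>1 \<le> d\<close> by simp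
  ultimately show ?thesis
    by (metis Suc_leI One_nat_def mult.right_neutral mult_le_mono)
qed

text \<open>
  At the critical point the power term collapses to \<open>B q^(t + 1) = r q / (t + 1)\<close>, so that the bound
  becomes \<open>r (1 - q t / (t + 1))\<close>.
\<close>

lemma optimal_value:
  fixes r B t :: nat and \<theta> \<rho> q :: real
  assumes "0 < r" and "0 < B" and "0 < t" and "\<theta> = real t" and "\<rho> = 1 / \<theta>"
    and q: "q = (real r / ((\<theta> + 1) * real B)) powr \<rho>"
  shows "real r * (1 - q) + real B * q ^ (t + 1)
           = (1 - (real r * \<rho>) powr \<rho> / ((1 + \<rho>) powr (1 + \<rho>) * real B powr \<rho>)) * real r"
proof -
  define x where "x = real r / ((\<theta> + 1) * real B)"
  have pos: "0 < \<theta>" "0 < \<rho>" "0 < x" using assms by (simp_all add: x_def)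
  have q_pow: "q ^ t = x"
  proof -
    have "q ^ t = x powr (\<rho> * real t)"
      using pos by (simp add: q x_def[symmetric] powr_powr flip: powr_realpow)
    then show ?thesis using assms pos by simp
  qed
  have "real B * q ^ (t + 1) = real B * x * q" by (simp add: q_pow)
  also have "real B * x = real r / (\<theta> + 1)" using assms by (simp add: x_def)
  finally have power_term: "real B * q ^ (t + 1) = real r / (\<theta> + 1) * q" .
  have succ_\<rho>: "1 + \<rho> = \<rho> * (\<theta> + 1)" using assms(5) pos by (simp add: field_simps)
  then have "x = real r * \<rho> / ((1 + \<rho>) * real B)"
    using pos by (simp add: x_def)
  then have "q = (real r * \<rho>) powr \<rho> / ((1 + \<rho>) powr \<rho> * real B powr \<rho>)"
    using pos by (simp add: q x_def[symmetric] powr_divide powr_mult)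
  then have "(real r * \<rho>) powr \<rho> / ((1 + \<rho>) powr (1 + \<rho>) * real B powr \<rho>) = q / (1 + \<rho>)"
    using pos by (simp add: powr_add)
  also have "\<dots> = q * (1 / (1 + \<rho>))" by simp
  also have "1 / (1 + \<rho>) = 1 - 1 / (\<theta> + 1)"
    unfolding succ_\<rho> using assms(5) pos by (simp add: field_simps)
  finally have subtracted: "(real r * \<rho>) powr \<rho> / ((1 + \<rho>) powr (1 + \<rho>) * real B powr \<rho>)
      = q * (1 - 1 / (\<theta> + 1))" .
  show ?thesis unfolding power_term subtracted by (simp add: algebra_simps)
qed

text \<open>
  Replacing \<open>1 - p\<close> by \<open>0\<close> when \<open>p > 1\<close> keeps both estimates \<open>1 - q \<le> p\<close> and \<open>q \<le> exp (- p)\<close> valid, so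
  that large \<open>p\<close> needs no separate treatment.
\<close>

lemma exponential_value:
  fixes r B t :: nat and \<theta> p q :: real
  assumes "0 < r" and "0 < B" and "\<theta> = real t"
    and p: "p = (ln (\<theta> + 1) + ln (real B) - ln (real r)) / (\<theta> + 1)" and q: "q = max 0 (1 - p)"
  shows "real r * (1 - q) + real B * q ^ (t + 1)
           \<le> (ln (\<theta> + 1) + ln (real B) - ln (real r) + 1) / (\<theta> + 1) * real r"
proof -
  have "0 < \<theta> + 1" using assms by simp
  have "q \<le> exp (- p)" using exp_ge_add_one_self[of "- p"] by (simp add: q)
  then have "q ^ (t + 1) \<le> exp (- p) ^ (t + 1)" by (intro power_mono) (simp_all add: q)
  also have "\<dots> = exp (- (p * (\<theta> + 1)))"
    by (simp only: exp_of_nat_mult[symmetric]) (simp add: assms(3) algebra_simps)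
  also have "- (p * (\<theta> + 1)) = ln (real r) - (ln (\<theta> + 1) + ln (real B))"
    using \<open>0 < \<theta> + 1\<close> by (simp add: p)
  also have "exp \<dots> = real r / ((\<theta> + 1) * real B)"
    using \<open>0 < \<theta> + 1\<close> assms by (simp add: exp_diff exp_add)
  finally have "real B * q ^ (t + 1) \<le> real B * (real r / ((\<theta> + 1) * real B))"
    by (rule mult_left_mono) simp
  also have "\<dots> = real r / (\<theta> + 1)" using assms by simp
  finally have "real B * q ^ (t + 1) \<le> real r / (\<theta> + 1)" .
  moreover have "real r * (1 - q) \<le> real r * p" by (intro mult_left_mono) (simp_all add: q)
  ultimately have "real r * (1 - q) + real B * q ^ (t + 1) \<le> (p + 1 / (\<theta> + 1)) * real r"
    by (simp add: algebra_simps)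
  then show ?thesis by (simp add: p add_divide_distrib)
qed

theorem corollary3:
  fixes G :: "('a, 'b) pre_digraph"
    and k n \<delta> r B :: nat
    and \<theta> \<rho> :: real
  assumes "graph G" and "verts G \<noteq> {}"
    and "k \<ge> 1"
    and "n = card (verts G)"
    and "\<delta> = min_degree G" and "\<delta> > 0"
    and "int r = \<lfloor>real k / real (\<delta> + 1)\<rfloor> + 1"
    and "\<theta> = real (\<delta> + 1) * real r - real k"
    and "B = ((\<delta> + 1) * r) choose (k - 1)"
    and "\<rho> = 1 / \<theta>"
  shows "real (k_domination_number k G)
           \<le> (1 - (real r * \<rho>) powr \<rho> / ((1 + \<rho>) powr (1 + \<rho>) * real B powr \<rho>)) * real r * real n
       \<and> real (k_domination_number k G)
           \<le> (ln (\<theta> + 1) + ln (real B) - ln (real r) + 1) / (\<theta> + 1) * real r * real n"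
proof -
  interpret graph G by fact
  define d where "d = \<delta> + 1"
  have "int r = int (k div d + 1)"
    using assms(7) floor_divide_of_nat_eq[of k d, where ?'a = real] by (simp add: d_def)
  then have r: "r = k div d + 1" by (simp only: of_nat_eq_iff)
  have "2 \<le> d" using \<open>\<delta> > 0\<close> by (simp add: d_def)
  have "0 < r" by (simp add: r)
  have "k < d * r"
    using dividend_less_times_div[of d k] \<open>2 \<le> d\<close> by (simp add: r algebra_simps)
  define t where "t = d * r - k"
  have dr: "d * r = k + t" and "0 < t" using \<open>k < d * r\<close> by (simp_all add: t_def)
  have "k div d < k" using \<open>k \<ge> 1\<close> \<open>2 \<le> d\<close> by (intro div_less_dividend) auto
  then have "r \<le> k" by (simp add: r)
  have "real d * real r = real k + real t" using dr by (metis of_nat_add of_nat_mult)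
  then have \<theta>: "\<theta> = real t" using assms(8) unfolding d_def by linarith
  have B: "B = d * r choose (k - 1)" using assms(9) by (simp add: d_def)
  have "0 < B" using \<open>k < d * r\<close> by (simp add: B zero_less_binomial)
  have "r \<le> (t + 1) * B"
    unfolding B using \<open>k \<ge> 1\<close> \<open>2 \<le> d\<close> dr by (intro tokens_le_binomial) auto
  then have "real r \<le> real ((t + 1) * B)" by (rule of_nat_mono)
  then have r_le: "real r \<le> (\<theta> + 1) * real B" by (simp add: \<theta> algebra_simps)
  have bound: "real (k_domination_number k G) \<le> c * real n"
    if "0 \<le> q" "q \<le> 1" "real r * (1 - q) + real B * q ^ (t + 1) \<le> c" for q c
  proof -
    have "real (k_domination_number k G)
        \<le> real r * real n * (1 - q) + real n * (real B * q ^ (t + 1))"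
      unfolding assms(4) B t_def
      using that(1,2) \<open>k \<ge> 1\<close> \<open>r \<le> k\<close> \<open>k < d * r\<close> min_degree_less_card_closed_nbhd
      by (intro k_domination_number_le_random) (simp_all add: d_def assms(5))
    also have "\<dots> = (real r * (1 - q) + real B * q ^ (t + 1)) * real n"
      by (simp add: algebra_simps)
    also have "\<dots> \<le> c * real n" using that(3) by (rule mult_right_mono) simp
    finally show ?thesis .
  qed
  show ?thesis
  proof
    define q where "q = (real r / ((\<theta> + 1) * real B)) powr \<rho>"
    have "0 \<le> \<rho>" by (simp add: assms(10) \<theta>)
    have "0 \<le> q" by (simp add: q_def)
    moreover have "q \<le> 1"
      unfolding q_def using r_le \<open>0 < B\<close> \<open>0 \<le> \<rho>\<close>
      by (intro powr_le1) (simp_all add: \<theta> divide_le_eq_1)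
    ultimately show "real (k_domination_number k G)
        \<le> (1 - (real r * \<rho>) powr \<rho> / ((1 + \<rho>) powr (1 + \<rho>) * real B powr \<rho>)) * real r * real n"
      by (rule bound[OF _ _ eq_refl[OF optimal_value[OF \<open>0 < r\<close> \<open>0 < B\<close> \<open>0 < t\<close> \<theta> assms(10) q_def]]])
  next
    define p where "p = (ln (\<theta> + 1) + ln (real B) - ln (real r)) / (\<theta> + 1)"
    define q where "q = max 0 (1 - p)"
    have "ln (real r) \<le> ln ((\<theta> + 1) * real B)" using r_le \<open>0 < r\<close> by (intro ln_mono) simp_all
    also have "\<dots> = ln (\<theta> + 1) + ln (real B)" using \<open>0 < B\<close> by (simp add: \<theta> ln_mult)
    finally have "0 \<le> p" by (simp add: p_def \<theta>)
    then have "0 \<le> q" and "q \<le> 1" by (simp_all add: q_def)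
    then show "real (k_domination_number k G)
        \<le> (ln (\<theta> + 1) + ln (real B) - ln (real r) + 1) / (\<theta> + 1) * real r * real n"
      by (rule bound[OF _ _ exponential_value[OF \<open>0 < r\<close> \<open>0 < B\<close> \<theta> p_def q_def]])
  qed
qed

end
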